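(* Let $\mathcal{A}$ be a C*-algebra and let $G$ be a finitely generated discrete group with polynomial growth, with word length $|\cdot|$, which acts on $\mathcal{A}$ by a group of *-automorphisms $\alpha_g$. Then there exist positive reals $M,s$ such that for every finitely supported operator $X=\sum_{g\in G}L_gX_g$ in $C^*_r(\mathcal{A}\rtimes_\alpha G)$, $$\|X\|\le M\Big\|\sum_{g\in G}(1+|g|)^{s+2}L_gX_gX_g^*L_g^*\Big\|^{1/2}\quad\text{and}\quad \|X\|\le M\Big\|\sum_{g\in G}(1+|g|)^{s+2}X_g^*X_g\Big\|^{1/2}.$$
   Context: Crossed product: for a discrete group $G$ acting on a C*-algebra $\mathcal{A}$ by *-automorphisms $\alpha_g$, $C^*_r(\mathcal{A}\rtimes_\alpha G)$ is the reduced crossed product with its operator norm $\|\cdot\|$. It contains a copy of $\mathcal{A}$, and $L_g$ ($g\in G$) denote the canonical unitaries (in the multiplier algebra if $\mathcal{A}$ is not unital) implementing the action: $L_gAL_g^*=\alpha_g(A)$ for $A\in\mathcal{A}$. A finitely supported element is a finite sum $X=\sum_{g\in G}L_gX_g$ with $X_g\in\mathcal{A}$, all but finitely many $X_g$ being zero. $|\cdot|$ is the word length with respect to a fixed finite generating set of $G$. Polynomial growth means that the number of elements of the ball $\{g\in G:|g|\le k\}$ is bounded by a polynomial in $k$; in particular there are positive reals $C,s$ with $|\{g\in G:k-1<|g|\le k\}|\le C(1+k)^s$ for all $k\in\mathbb{N}_0$. *)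

theory Defs
  imports "HOL-Analysis.Analysis"
begin

section \<open>Complex normed spaces, Hilbert spaces and C*-algebras\<close>

class complex_normed_vector = real_normed_vector +
  fixes scaleC :: "complex \<Rightarrow> 'a \<Rightarrow> 'a"  (infixr \<open>*\<^sub>C\<close> 75)
  assumes scaleC_add_right: "c *\<^sub>C (x + y) = c *\<^sub>C x + c *\<^sub>C y"
    and scaleC_add_left: "(c + d) *\<^sub>C x = c *\<^sub>C x + d *\<^sub>C x"
    and scaleC_scaleC: "c *\<^sub>C d *\<^sub>C x = (c * d) *\<^sub>C x"
    and scaleC_of_real: "complex_of_real r *\<^sub>C x = r *\<^sub>R x"
    and norm_scaleC: "norm (c *\<^sub>C x) = cmod c * norm x"

text \<open>C*-algebras are not assumed to be unital.\<close>

class cstar_algebra = complex_normed_vector + real_normed_algebra + complete_space +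
  fixes adj :: "'a \<Rightarrow> 'a"
  assumes mult_scaleC_left: "(c *\<^sub>C a) * b = c *\<^sub>C (a * b)"
    and mult_scaleC_right: "a * (c *\<^sub>C b) = c *\<^sub>C (a * b)"
    and adj_adj: "adj (adj a) = a"
    and adj_add: "adj (a + b) = adj a + adj b"
    and adj_scaleC: "adj (c *\<^sub>C a) = cnj c *\<^sub>C adj a"
    and adj_mult: "adj (a * b) = adj b * adj a"
    and norm_adj_mult_self: "norm (adj a * a) = (norm a)\<^sup>2"

text \<open>The inner product is conjugate linear in its first argument; the last axiom ties it to the
  norm and contains its positive definiteness.\<close>

class complex_inner = complex_normed_vector +
  fixes cinner :: "'a \<Rightarrow> 'a \<Rightarrow> complex"
  assumes cinner_commute: "cinner x y = cnj (cinner y x)"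
    and cinner_add_right: "cinner x (y + z) = cinner x y + cinner x z"
    and cinner_scaleC_right: "cinner x (c *\<^sub>C y) = c * cinner x y"
    and cinner_self: "cinner x x = complex_of_real ((norm x)\<^sup>2)"

class complex_hilbert = complex_inner + complete_space

lemma cinner_add_left: "cinner (x + y) z = cinner x z + cinner y z"
  for x y z :: "'a::complex_inner"
  by (metis cinner_add_right cinner_commute complex_cnj_add)

lemma cinner_scaleC_left: "cinner (c *\<^sub>C x) y = cnj c * cinner x y"
  for x y :: "'a::complex_inner"
  by (metis cinner_commute cinner_scaleC_right complex_cnj_mult)

lemma scaleC_minus_one: "(-1) *\<^sub>C x = - x" for x :: "'a::complex_normed_vector"
  using scaleC_of_real[of "-1" x] by simp

lemma cmod_cinner_le: "2 * cmod (cinner x y) \<le> (norm x)\<^sup>2 + (norm y)\<^sup>2"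
  for x y :: "'a::complex_inner"
proof -
  define z where "z = cinner x y"
  define u where "u = (if z = 0 then 1 else - sgn z)"
  have u1: "cmod u = 1"
    by (simp add: u_def norm_sgn)
  have u2: "cnj u * z = - of_real (cmod z)"
  proof (cases "z = 0")
    case False
    have "cnj u * z = - (z * cnj z) / of_real (cmod z)"
      using False by (simp add: u_def sgn_eq mult.commute)
    also have "\<dots> = - of_real (cmod z)"
      using False by (simp add: complex_norm_square[symmetric] power2_eq_square)
    finally show ?thesis .
  qed simp
  have "cinner (u *\<^sub>C x + y) (u *\<^sub>C x + y) =
      of_real ((norm x)\<^sup>2) + (cnj u * z + cnj (cnj u * z)) + of_real ((norm y)\<^sup>2)"
    using u1 cinner_self[of "u *\<^sub>C x"] cinner_self[of y] cinner_commute[of y x]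
    by (simp add: cinner_add_left cinner_add_right cinner_scaleC_left[of u x y]
        cinner_scaleC_right[of y u x] norm_scaleC z_def algebra_simps)
  also have "\<dots> = of_real ((norm x)\<^sup>2 - 2 * cmod z + (norm y)\<^sup>2)"
    using u2 by simp
  finally have "of_real ((norm (u *\<^sub>C x + y))\<^sup>2) = complex_of_real ((norm x)\<^sup>2 - 2 * cmod z + (norm y)\<^sup>2)"
    by (simp add: cinner_self)
  then have "(norm (u *\<^sub>C x + y))\<^sup>2 = (norm x)\<^sup>2 - 2 * cmod z + (norm y)\<^sup>2"
    unfolding of_real_eq_iff .
  then show ?thesis
    using zero_le_power2[of "norm (u *\<^sub>C x + y)"] by (simp add: z_def)
qed

lemma cmod_cinner_le_mult: "cmod (cinner x y) \<le> norm x * norm y"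
  for x y :: "'a::complex_inner"
proof (cases "x = 0 \<or> y = 0")
  case True
  have "cinner z 0 = 0" "cinner 0 z = 0" for z :: 'a
    using cinner_add_right[of z 0 0] cinner_add_left[of 0 0 z] by simp_all
  with True show ?thesis by auto
next
  case False
  let ?u = "complex_of_real (1 / norm x) *\<^sub>C x" and ?v = "complex_of_real (1 / norm y) *\<^sub>C y"
  have "norm ?u = 1" "norm ?v = 1"
    using False by (simp_all add: norm_scaleC norm_divide)
  then have "cmod (cinner ?u ?v) \<le> 1"
    using cmod_cinner_le[of ?u ?v] by simp
  then show ?thesis
    using False
    by (simp add: cinner_scaleC_left cinner_scaleC_right norm_mult norm_divide field_simps)
qed


section \<open>The Hilbert space of square-summable families\<close>

typedef (overloaded) ('i, 'h) ell2 =
  "{\<xi> :: 'i \<Rightarrow> 'h::complex_inner. (\<lambda>i. (norm (\<xi> i))\<^sup>2) summable_on UNIV}"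
  morphisms ell2_nth Abs_ell2
  by (rule exI[of _ "\<lambda>_. 0"]) simp

setup_lifting type_definition_ell2

lemma ell2_summable: "(\<lambda>i. (norm (ell2_nth \<xi> i))\<^sup>2) summable_on UNIV"
  using ell2_nth by blast

lemma norm_add_square_le: "(norm (x + y))\<^sup>2 \<le> 2 * (norm x)\<^sup>2 + 2 * (norm y)\<^sup>2"
  for x y :: "'a::real_normed_vector"
proof -
  have "(norm (x + y))\<^sup>2 \<le> (norm x + norm y)\<^sup>2"
    by (simp add: norm_triangle_ineq)
  also have "\<dots> \<le> 2 * (norm x)\<^sup>2 + 2 * (norm y)\<^sup>2"
    using sum_squares_bound[of "norm x" "norm y"] by (simp add: power2_sum)
  finally show ?thesis .
qed

lemma ell2_add_summable:
  fixes f g :: "'i \<Rightarrow> 'h::complex_inner"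
  assumes "(\<lambda>i. (norm (f i))\<^sup>2) summable_on UNIV" "(\<lambda>i. (norm (g i))\<^sup>2) summable_on UNIV"
  shows "(\<lambda>i. (norm (f i + g i))\<^sup>2) summable_on UNIV"
proof (rule summable_on_comparison_test)
  show "(\<lambda>i. 2 * (norm (f i))\<^sup>2 + 2 * (norm (g i))\<^sup>2) summable_on UNIV"
    by (intro summable_on_add summable_on_cmult_right assms)
qed (auto simp: norm_add_square_le)

lemma ell2_scale_summable:
  fixes f :: "'i \<Rightarrow> 'h::complex_inner"
  assumes "(\<lambda>i. (norm (f i))\<^sup>2) summable_on UNIV"
  shows "(\<lambda>i. (norm (c *\<^sub>C f i))\<^sup>2) summable_on UNIV"
  using summable_on_cmult_right[OF assms, of "(cmod c)\<^sup>2"]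
  by (simp add: norm_scaleC power_mult_distrib)

instantiation ell2 :: (type, complex_inner) complex_inner
begin

lift_definition zero_ell2 :: "('a, 'b) ell2" is "\<lambda>_. 0" by simp

lift_definition plus_ell2 :: "('a, 'b) ell2 \<Rightarrow> ('a, 'b) ell2 \<Rightarrow> ('a, 'b) ell2"
  is "\<lambda>f g i. f i + g i" by (rule ell2_add_summable)

lift_definition uminus_ell2 :: "('a, 'b) ell2 \<Rightarrow> ('a, 'b) ell2" is "\<lambda>f i. - f i" by simp

lift_definition minus_ell2 :: "('a, 'b) ell2 \<Rightarrow> ('a, 'b) ell2 \<Rightarrow> ('a, 'b) ell2"
  is "\<lambda>f g i. f i - g i"
  using ell2_add_summable[where g = "\<lambda>i. - _ i"] 
  by (simp only: norm_minus_cancel diff_conv_add_uminus)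

lift_definition scaleC_ell2 :: "complex \<Rightarrow> ('a, 'b) ell2 \<Rightarrow> ('a, 'b) ell2"
  is "\<lambda>c f i. c *\<^sub>C f i" by (rule ell2_scale_summable)

lift_definition scaleR_ell2 :: "real \<Rightarrow> ('a, 'b) ell2 \<Rightarrow> ('a, 'b) ell2"
  is "\<lambda>r f i. r *\<^sub>R f i"
  using ell2_scale_summable[where c = "complex_of_real _"] by (simp only: scaleC_of_real)

definition norm_ell2 :: "('a, 'b) ell2 \<Rightarrow> real" where
  "norm_ell2 \<xi> = sqrt (\<Sum>\<^sub>\<infinity>i. (norm (ell2_nth \<xi> i))\<^sup>2)"

definition cinner_ell2 :: "('a, 'b) ell2 \<Rightarrow> ('a, 'b) ell2 \<Rightarrow> complex" where
  "cinner_ell2 \<xi> \<eta> = (\<Sum>\<^sub>\<infinity>i. cinner (ell2_nth \<xi> i) (ell2_nth \<eta> i))"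

definition dist_ell2 :: "('a, 'b) ell2 \<Rightarrow> ('a, 'b) ell2 \<Rightarrow> real" where
  "dist_ell2 \<xi> \<eta> = norm (\<xi> - \<eta>)"

definition sgn_ell2 :: "('a, 'b) ell2 \<Rightarrow> ('a, 'b) ell2" where
  "sgn_ell2 \<xi> = inverse (norm \<xi>) *\<^sub>R \<xi>"

definition uniformity_ell2 :: "(('a, 'b) ell2 \<times> ('a, 'b) ell2) filter" where
  "uniformity_ell2 = (INF e\<in>{0 <..}. principal {(x, y). dist x y < e})"

definition open_ell2 :: "('a, 'b) ell2 set \<Rightarrow> bool" where
  "open_ell2 U \<longleftrightarrow> (\<forall>x\<in>U. eventually (\<lambda>(x', y). x' = x \<longrightarrow> y \<in> U) uniformity)"

lemma ell2_norm_sq: "(norm \<xi>)\<^sup>2 = (\<Sum>\<^sub>\<infinity>i. (norm (ell2_nth \<xi> i))\<^sup>2)" for \<xi> :: "('a, 'b) ell2"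
  by (simp add: norm_ell2_def infsum_nonneg)

lemma ell2_norm_ge0: "0 \<le> norm \<xi>" for \<xi> :: "('a, 'b) ell2"
  by (simp add: norm_ell2_def infsum_nonneg)

lemma ell2_L2_set_le: "finite F \<Longrightarrow> L2_set (\<lambda>i. norm (ell2_nth \<xi> i)) F \<le> norm \<xi>"
  for \<xi> :: "('a, 'b) ell2"
  unfolding L2_set_def norm_ell2_def
  by (intro real_sqrt_le_mono finite_sum_le_infsum ell2_summable) auto

lemma ell2_cinner_summable:
  "(\<lambda>i. cinner (ell2_nth \<xi> i) (ell2_nth \<eta> i)) summable_on UNIV" for \<xi> \<eta> :: "('a, 'b) ell2"
proof (rule abs_summable_summable, rule summable_on_comparison_test)
  show "(\<lambda>i. (norm (ell2_nth \<xi> i))\<^sup>2 + (norm (ell2_nth \<eta> i))\<^sup>2) summable_on UNIV"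
    by (intro summable_on_add ell2_summable)
  show "cmod (cinner (ell2_nth \<xi> i) (ell2_nth \<eta> i)) \<le> (norm (ell2_nth \<xi> i))\<^sup>2 + (norm (ell2_nth \<eta> i))\<^sup>2" for i
    using cmod_cinner_le[of "ell2_nth \<xi> i" "ell2_nth \<eta> i"]
      norm_ge_zero[of "cinner (ell2_nth \<xi> i) (ell2_nth \<eta> i)"] by linarith
qed simp

instance
proof
  fix x y z :: "('a, 'b) ell2" and r s :: real and c d :: complex
  show "x + y + z = x + (y + z)" "x + y = y + x" "0 + x = x" "- x + x = 0" "x - y = x + - y"
    by (transfer; simp add: algebra_simps)+
  show "r *\<^sub>R (x + y) = r *\<^sub>R x + r *\<^sub>R y" "(r + s) *\<^sub>R x = r *\<^sub>R x + s *\<^sub>R x"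
    "r *\<^sub>R s *\<^sub>R x = (r * s) *\<^sub>R x" "1 *\<^sub>R x = x"
    by (transfer; simp add: algebra_simps)+
  show "c *\<^sub>C (x + y) = c *\<^sub>C x + c *\<^sub>C y" "(c + d) *\<^sub>C x = c *\<^sub>C x + d *\<^sub>C x"
    "c *\<^sub>C d *\<^sub>C x = (c * d) *\<^sub>C x" "complex_of_real r *\<^sub>C x = r *\<^sub>R x"
    by (transfer; simp add: scaleC_add_left scaleC_add_right scaleC_scaleC scaleC_of_real)+
  show "dist x y = norm (x - y)" by (rule dist_ell2_def)
  show "sgn x = inverse (norm x) *\<^sub>R x" by (rule sgn_ell2_def)
  show "uniformity = (INF e\<in>{0<..}. principal {(x, y :: ('a, 'b) ell2). dist x y < e})"
    by (rule uniformity_ell2_def)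
  show "open U \<longleftrightarrow> (\<forall>x\<in>U. eventually (\<lambda>(x', y). x' = x \<longrightarrow> y \<in> U) uniformity)" for U :: "('a, 'b) ell2 set"
    by (rule open_ell2_def)
  show "norm x = 0 \<longleftrightarrow> x = 0"
  proof
    assume "norm x = 0"
    then have "(\<Sum>\<^sub>\<infinity>i. (norm (ell2_nth x i))\<^sup>2) = 0"
      by (simp add: norm_ell2_def infsum_nonneg)
    then have "(norm (ell2_nth x i))\<^sup>2 = 0" for i
      by (intro nonneg_infsum_le_0D[where A = UNIV]) (auto simp: ell2_summable)
    then show "x = 0"
      by (intro ell2_nth_inject[THEN iffD1]) (auto simp: zero_ell2.rep_eq)
  qed (simp add: norm_ell2_def zero_ell2.rep_eq)
  show "norm (x + y) \<le> norm x + norm y"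
  proof -
    have "(\<Sum>\<^sub>\<infinity>i. (norm (ell2_nth (x + y) i))\<^sup>2) \<le> (norm x + norm y)\<^sup>2"
    proof (rule infsum_le_finite_sums)
      fix F :: "'a set" assume F: "finite F"
      have "L2_set (\<lambda>i. norm (ell2_nth (x + y) i)) F
          \<le> L2_set (\<lambda>i. norm (ell2_nth x i) + norm (ell2_nth y i)) F"
        by (intro L2_set_mono) (auto simp: plus_ell2.rep_eq norm_triangle_ineq)
      also have "\<dots> \<le> norm x + norm y"
        by (rule order_trans[OF L2_set_triangle_ineq add_mono[OF ell2_L2_set_le[OF F] ell2_L2_set_le[OF F]]])
      finally show "(\<Sum>i\<in>F. (norm (ell2_nth (x + y) i))\<^sup>2) \<le> (norm x + norm y)\<^sup>2"
        unfolding L2_set_def by (rule sqrt_le_D)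
    qed (rule ell2_summable)
    then show ?thesis
      using ell2_norm_ge0[of x] ell2_norm_ge0[of y] ell2_norm_sq[of "x + y"]
      by (intro power2_le_imp_le[of "norm (x + y)"]) auto
  qed
  show *: "norm (c *\<^sub>C x) = cmod c * norm x" for c
    by (simp add: norm_ell2_def scaleC_ell2.rep_eq norm_scaleC power_mult_distrib
        infsum_cmult_right' real_sqrt_mult)
  show "norm (r *\<^sub>R x) = \<bar>r\<bar> * norm x"
    by (simp add: norm_ell2_def scaleR_ell2.rep_eq power_mult_distrib
        infsum_cmult_right' real_sqrt_mult)
  show "cinner x y = cnj (cinner y x)"
    unfolding cinner_ell2_def infsum_cnj[symmetric] by (intro infsum_cong cinner_commute)
  show "cinner x (y + z) = cinner x y + cinner x z"
    unfolding cinner_ell2_def plus_ell2.rep_eq cinner_add_right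
    by (intro infsum_add ell2_cinner_summable)
  show "cinner x (c *\<^sub>C y) = c * cinner x y"
    unfolding cinner_ell2_def scaleC_ell2.rep_eq cinner_scaleC_right
    by (rule infsum_cmult_right')
  show "cinner x x = complex_of_real ((norm x)\<^sup>2)"
    unfolding cinner_ell2_def ell2_norm_sq cinner_self
    by (intro infsumI has_sum_of_real has_sum_infsum ell2_summable)
qed

end

lemma ell2_norm_nth_le: "norm (ell2_nth \<xi> i) \<le> norm \<xi>"
  for \<xi> :: "('i, 'h::complex_inner) ell2"
  using ell2_L2_set_le[of "{i}" \<xi>] by simp

instance ell2 :: (type, complex_hilbert) complex_hilbert
proof
  fix X :: "nat \<Rightarrow> ('a, 'b) ell2"
  assume X: "Cauchy X"
  have "Cauchy (\<lambda>n. ell2_nth (X n) i)" for i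
  proof (rule metric_CauchyI)
    fix e :: real assume "0 < e"
    then obtain M where M: "\<And>m n. m \<ge> M \<Longrightarrow> n \<ge> M \<Longrightarrow> dist (X m) (X n) < e"
      using metric_CauchyD[OF X] by blast
    have "dist (ell2_nth (X m) i) (ell2_nth (X n) i) \<le> dist (X m) (X n)" for m n
      using ell2_norm_nth_le[of "X m - X n" i] by (simp add: dist_norm minus_ell2.rep_eq)
    then show "\<exists>M. \<forall>m\<ge>M. \<forall>n\<ge>M. dist (ell2_nth (X m) i) (ell2_nth (X n) i) < e"
      using M by (meson le_less_trans)
  qed
  then obtain l where l: "\<And>i. (\<lambda>n. ell2_nth (X n) i) \<longlonglongrightarrow> l i"
    unfolding Cauchy_convergent_iff convergent_def by metis
  have bound: "(\<Sum>i\<in>F. (norm (l i - ell2_nth (X m) i))\<^sup>2) \<le> e\<^sup>2"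
    if "finite F" "0 < e" "\<And>n. n \<ge> M \<Longrightarrow> dist (X n) (X m) < e" for F e m M
  proof (rule LIMSEQ_le_const2)
    show "(\<lambda>n. \<Sum>i\<in>F. (norm (ell2_nth (X n) i - ell2_nth (X m) i))\<^sup>2)
        \<longlonglongrightarrow> (\<Sum>i\<in>F. (norm (l i - ell2_nth (X m) i))\<^sup>2)"
      by (intro tendsto_intros l)
    have "(\<Sum>i\<in>F. (norm (ell2_nth (X n) i - ell2_nth (X m) i))\<^sup>2) \<le> e\<^sup>2" if "n \<ge> M" for n
    proof -
      have "L2_set (\<lambda>i. norm (ell2_nth (X n - X m) i)) F \<le> e"
        using ell2_L2_set_le[OF \<open>finite F\<close>, of "X n - X m"] that(1)
          \<open>\<And>n. n \<ge> M \<Longrightarrow> dist (X n) (X m) < e\<close>[of n] by (simp add: dist_norm)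
      then show ?thesis
        unfolding L2_set_def minus_ell2.rep_eq by (rule sqrt_le_D)
    qed
    then show "\<exists>N. \<forall>n\<ge>N. (\<Sum>i\<in>F. (norm (ell2_nth (X n) i - ell2_nth (X m) i))\<^sup>2) \<le> e\<^sup>2"
      by blast
  qed
  obtain M1 where M1: "\<And>m n. m \<ge> M1 \<Longrightarrow> n \<ge> M1 \<Longrightarrow> dist (X m) (X n) < 1"
    using metric_CauchyD[OF X, of 1] by auto
  have "(\<lambda>i. (norm (l i - ell2_nth (X M1) i))\<^sup>2) summable_on UNIV"
    by (rule nonneg_bdd_above_summable_on)
      (use bound[of _ 1 M1 M1] M1 in \<open>auto intro!: bdd_aboveI[where M = 1]\<close>)
  from ell2_add_summable[OF this ell2_summable[of "X M1"]]
  have "(\<lambda>i. (norm (l i))\<^sup>2) summable_on UNIV" by simp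
  then have nth: "ell2_nth (Abs_ell2 l) = l"
    by (simp add: Abs_ell2_inverse)
  have "X \<longlonglongrightarrow> Abs_ell2 l"
  proof (rule metric_LIMSEQ_I)
    fix e :: real assume e: "0 < e"
    then obtain M where M: "\<And>m n. m \<ge> M \<Longrightarrow> n \<ge> M \<Longrightarrow> dist (X m) (X n) < e / 2"
      using metric_CauchyD[OF X, of "e / 2"] by auto
    have "dist (X m) (Abs_ell2 l) < e" if "m \<ge> M" for m
    proof -
      have "(norm (Abs_ell2 l - X m))\<^sup>2 \<le> (e / 2)\<^sup>2"
        unfolding ell2_norm_sq
      proof (rule infsum_le_finite_sums[OF ell2_summable])
        fix F :: "'a set" assume "finite F"
        then show "(\<Sum>i\<in>F. (norm (ell2_nth (Abs_ell2 l - X m) i))\<^sup>2) \<le> (e / 2)\<^sup>2"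
          unfolding minus_ell2.rep_eq nth by (rule bound) (use M that e in simp_all)
      qed
      then have "norm (Abs_ell2 l - X m) \<le> e / 2"
        by (rule power2_le_imp_le) (use e in simp)
      then show ?thesis
        using e by (simp add: dist_norm norm_minus_commute)
    qed
    then show "\<exists>M. \<forall>m\<ge>M. dist (X m) (Abs_ell2 l) < e" by blast
  qed
  then show "convergent X" by (auto simp: convergent_def)
qed


section \<open>Bounded operators\<close>

text \<open>The operators used below are complex linear, although the library type of bounded linear maps
  only records linearity over the reals; the norm of that type is the operator norm.\<close>

definition is_cadjoint :: "('h::complex_hilbert \<Rightarrow>\<^sub>L 'h) \<Rightarrow> ('h \<Rightarrow>\<^sub>L 'h) \<Rightarrow> bool" where
  "is_cadjoint S T \<longleftrightarrow> (\<forall>x y. cinner (S x) y = cinner x (T y))"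

definition cadjoint :: "('h::complex_hilbert \<Rightarrow>\<^sub>L 'h) \<Rightarrow> ('h \<Rightarrow>\<^sub>L 'h)" where
  "cadjoint T = (THE S. is_cadjoint S T)"

lemma cadjoint_eqI:
  assumes "is_cadjoint S T"
  shows "cadjoint T = S"
  unfolding cadjoint_def
proof (rule the_equality)
  fix S' assume S': "is_cadjoint S' T"
  show "S' = S"
  proof (rule blinfun_eqI)
    fix x
    let ?z = "S' x + (-1) *\<^sub>C S x"
    have "cinner ?z ?z = 0"
      using assms S'
      by (simp only: cinner_add_left cinner_scaleC_left is_cadjoint_def) simp
    then have "?z = 0"
      by (simp add: cinner_self)
    then show "S' x = S x"
      by (simp add: scaleC_minus_one)
  qed
qed (rule assms)


section \<open>Actions, representations and the reduced crossed product\<close>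

definition star_automorphism :: "('a::cstar_algebra \<Rightarrow> 'a) \<Rightarrow> bool" where
  "star_automorphism \<phi> \<longleftrightarrow> bij \<phi> \<and>
     (\<forall>a b. \<phi> (a + b) = \<phi> a + \<phi> b) \<and>
     (\<forall>c a. \<phi> (c *\<^sub>C a) = c *\<^sub>C \<phi> a) \<and>
     (\<forall>a b. \<phi> (a * b) = \<phi> a * \<phi> b) \<and>
     (\<forall>a. \<phi> (adj a) = adj (\<phi> a))"

text \<open>Groups, which need not be commutative, are written additively.\<close>

definition star_action :: "('g::group_add \<Rightarrow> 'a::cstar_algebra \<Rightarrow> 'a) \<Rightarrow> bool" where
  "star_action \<alpha> \<longleftrightarrow> (\<forall>g. star_automorphism (\<alpha> g)) \<and>
     \<alpha> 0 = id \<and> (\<forall>g h. \<alpha> (g + h) = \<alpha> g \<circ> \<alpha> h)"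

definition star_representation ::
    "('a::cstar_algebra \<Rightarrow> ('h::complex_hilbert \<Rightarrow>\<^sub>L 'h)) \<Rightarrow> bool" where
  "star_representation \<pi> \<longleftrightarrow>
     (\<forall>a c x. \<pi> a (c *\<^sub>C x) = c *\<^sub>C \<pi> a x) \<and>
     (\<forall>a b. \<pi> (a + b) = \<pi> a + \<pi> b) \<and>
     (\<forall>c a x. \<pi> (c *\<^sub>C a) x = c *\<^sub>C \<pi> a x) \<and>
     (\<forall>a b. \<pi> (a * b) = \<pi> a o\<^sub>L \<pi> b) \<and>
     (\<forall>a. is_cadjoint (\<pi> (adj a)) (\<pi> a))"

definition faithful_representation ::
    "('a::cstar_algebra \<Rightarrow> ('h::complex_hilbert \<Rightarrow>\<^sub>L 'h)) \<Rightarrow> bool" where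
  "faithful_representation \<pi> \<longleftrightarrow> star_representation \<pi> \<and> inj \<pi>"

lemma star_representationD:
  assumes "star_representation \<pi>"
  shows "\<pi> a (c *\<^sub>C x) = c *\<^sub>C \<pi> a x" "\<pi> (a + b) = \<pi> a + \<pi> b" "\<pi> (c *\<^sub>C a) x = c *\<^sub>C \<pi> a x"
    "\<pi> (a * b) = \<pi> a o\<^sub>L \<pi> b" "cinner (\<pi> (adj a) x) y = cinner x (\<pi> a y)"
  using assms by (simp_all add: star_representation_def is_cadjoint_def)

text \<open>Representations are automatically contractive; this is what makes the copy of the algebra
  on \<open>\<ell>\<^sup>2(G, H)\<close> below consist of bounded operators.\<close>

lemma star_representation_norm_le_selfadjoint:
  fixes \<pi> :: "'a::cstar_algebra \<Rightarrow> ('h::complex_hilbert \<Rightarrow>\<^sub>L 'h)"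
  assumes \<pi>: "star_representation \<pi>" and b: "adj b = b"
  shows "norm (\<pi> b) \<le> norm b"
proof (rule ccontr)
  assume "\<not> norm (\<pi> b) \<le> norm b"
  define t where "t = norm (\<pi> b)"
  have t: "0 < t" "norm b < t"
    using \<open>\<not> norm (\<pi> b) \<le> norm b\<close> by (auto simp: t_def intro: le_less_trans[OF norm_ge_zero])
  define c where "c = (1 / t) *\<^sub>R b"
  define d where "d = c * c"
  define T where "T = \<pi> c"
  have T_eq: "T = (1 / t) *\<^sub>R \<pi> b"
  proof (rule blinfun_eqI)
    show "T x = ((1 / t) *\<^sub>R \<pi> b) x" for x
      using star_representationD(3)[OF \<pi>, of "complex_of_real (1 / t)" b x]
      unfolding T_def c_def scaleC_of_real by (simp add: blinfun.scaleR_left)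
  qed
  have T1: "norm T = 1"
    using t by (simp add: T_eq t_def)
  have "adj c = c"
    using adj_scaleC[of "complex_of_real (1 / t)" b]
    unfolding c_def complex_cnj_complex_of_real scaleC_of_real b .
  then have sa: "cinner (T x) y = cinner x (T y)" for x y
    using star_representationD(5)[OF \<pi>, of c x y] by (simp add: T_def)
  have "norm c < 1"
    using t by (simp add: c_def)
  then have "norm c * norm c < 1"
    using mult_strict_mono[of "norm c" 1 "norm c" 1] by simp
  then have d: "norm d < 1"
    unfolding d_def using norm_mult_ineq le_less_trans by blast
  have "\<exists>!q\<in>UNIV. d + q * d = q"
  proof (rule Banach_fix)
    show "dist (d + x * d) (d + y * d) \<le> norm d * dist x y" for x y
      using norm_mult_ineq[of "x - y" d] by (simp add: dist_norm algebra_simps)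
  qed (use d in \<open>auto simp: complete_UNIV\<close>)
  then obtain q where "d + q * d = q" by blast
  then have "\<pi> q = \<pi> (d + q * d)" by simp
  then have q: "\<pi> q = (T o\<^sub>L T) + (\<pi> q o\<^sub>L (T o\<^sub>L T))"
    unfolding T_def d_def star_representationD(2)[OF \<pi>] star_representationD(4)[OF \<pi>] .
  define K where "K = 1 + norm (\<pi> q)"
  have K: "1 \<le> K" by (simp add: K_def)
  have low: "norm x \<le> K * norm (x - T (T x))" for x
  proof -
    have "\<pi> q x = T (T x) + \<pi> q (T (T x))"
      using arg_cong[OF q, of "\<lambda>U. blinfun_apply U x"] by (simp add: blinfun.add_left)
    then have "x = (x - T (T x)) + \<pi> q (x - T (T x))"
      by (simp add: blinfun.diff_right)
    then have "norm x \<le> norm (x - T (T x)) + norm (\<pi> q (x - T (T x)))"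
      using norm_triangle_ineq[of "x - T (T x)" "\<pi> q (x - T (T x))"] by simp
    also have "\<dots> \<le> K * norm (x - T (T x))"
      using norm_blinfun[of "\<pi> q" "x - T (T x)"] by (simp add: K_def algebra_simps)
    finally show ?thesis .
  qed
  have sq: "(norm (x - T (T x)))\<^sup>2 \<le> 2 * (norm x)\<^sup>2 - 2 * (norm (T x))\<^sup>2" for x
  proof -
    have "complex_of_real ((norm (x + (-1) *\<^sub>C T (T x)))\<^sup>2) =
        of_real ((norm x)\<^sup>2 - 2 * (norm (T x))\<^sup>2 + (norm (T (T x)))\<^sup>2)"
      unfolding of_real_add of_real_diff of_real_mult cinner_self[symmetric]
      using sa[of x "T x"] sa[of "T x" x]
      by (simp add: cinner_add_left cinner_add_right cinner_scaleC_left cinner_scaleC_right)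
    then have "(norm (x - T (T x)))\<^sup>2 = (norm x)\<^sup>2 - 2 * (norm (T x))\<^sup>2 + (norm (T (T x)))\<^sup>2"
      unfolding of_real_eq_iff by (simp add: scaleC_minus_one)
    moreover have "norm (T (T x)) \<le> norm x"
      using norm_blinfun[of T "T x"] norm_blinfun[of T x] T1 by simp
    ultimately show ?thesis
      using power_mono[of "norm (T (T x))" "norm x" 2] by simp
  qed
  define r where "r = 1 - 1 / (2 * K\<^sup>2)"
  have K2: "1 \<le> 2 * K\<^sup>2"
    using one_le_power[OF K, of 2] by linarith
  then have r: "0 \<le> r" "r < 1"
    using K by (auto simp: r_def field_simps)
  have "norm (T x) \<le> sqrt r * norm x" for x
  proof -
    have "(norm x)\<^sup>2 \<le> K\<^sup>2 * (norm (x - T (T x)))\<^sup>2"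
      using power_mono[OF low[of x] norm_ge_zero, of 2] by (simp add: power_mult_distrib)
    also have "\<dots> \<le> K\<^sup>2 * (2 * (norm x)\<^sup>2 - 2 * (norm (T x))\<^sup>2)"
      by (intro mult_left_mono sq) simp
    finally have "(norm (T x))\<^sup>2 \<le> r * (norm x)\<^sup>2"
      using K by (simp add: r_def field_simps)
    then show ?thesis
      by (intro power2_le_imp_le[of "norm (T x)"]) (use r in \<open>simp_all add: power_mult_distrib\<close>)
  qed
  then have "norm T \<le> sqrt r"
    using r by (intro norm_blinfun_bound) auto
  moreover have "sqrt r < 1"
    using r by simp
  ultimately show False
    using T1 by simp
qed

lemma star_representation_norm_le:
  fixes \<pi> :: "'a::cstar_algebra \<Rightarrow> ('h::complex_hilbert \<Rightarrow>\<^sub>L 'h)"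
  assumes \<pi>: "star_representation \<pi>"
  shows "norm (\<pi> a) \<le> norm a"
proof (rule norm_blinfun_bound)
  fix x
  have "adj (adj a * a) = adj a * a"
    by (simp add: adj_mult adj_adj)
  then have "norm (\<pi> (adj a * a)) \<le> (norm a)\<^sup>2"
    using star_representation_norm_le_selfadjoint[OF \<pi>] by (simp add: norm_adj_mult_self[symmetric])
  then have 1: "norm (\<pi> (adj a * a) x) \<le> (norm a)\<^sup>2 * norm x"
    by (meson mult_right_mono norm_blinfun norm_ge_zero order_trans)
  have "of_real ((norm (\<pi> a x))\<^sup>2) = cinner (\<pi> (adj a * a) x) x"
    unfolding cinner_self[symmetric]
    by (simp add: star_representationD(4,5)[OF \<pi>])
  then have "(norm (\<pi> a x))\<^sup>2 \<le> norm (\<pi> (adj a * a) x) * norm x"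
    using cmod_cinner_le_mult[of "\<pi> (adj a * a) x" x] arg_cong[of _ _ cmod]
    by (metis abs_power2 norm_of_real)
  also have "\<dots> \<le> ((norm a)\<^sup>2 * norm x) * norm x"
    by (intro mult_right_mono 1) simp
  also have "\<dots> = (norm a * norm x)\<^sup>2"
    by (simp add: power2_eq_square)
  finally show "norm (\<pi> a x) \<le> norm a * norm x"
    by (rule power2_le_imp_le) simp
qed simp

lemma star_representation_compose:
  assumes "star_representation \<pi>" "star_automorphism \<phi>"
  shows "star_representation (\<lambda>a. \<pi> (\<phi> a))"
  using assms(2) unfolding star_representation_def star_automorphism_def is_cadjoint_def
  by (simp add: star_representationD[OF assms(1)])

lemma bij_add_left: "bij (\<lambda>h. - g + h)" for g :: "'g::group_add"
  by (rule bij_betw_byWitness[where f' = "\<lambda>h. g + h"]) (auto simp: algebra_simps)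

lift_definition translate :: "'g::group_add \<Rightarrow> ('g, 'h::complex_inner) ell2 \<Rightarrow> ('g, 'h) ell2"
  is "\<lambda>g \<xi> h. \<xi> (- g + h)"
  subgoal for g \<xi>
    using summable_on_reindex_bij_betw[OF bij_add_left[of g], of "\<lambda>h. (norm (\<xi> h))\<^sup>2"] by simp
  done

lemma norm_translate: "norm (translate g \<xi>) = norm \<xi>"
  unfolding norm_ell2_def translate.rep_eq
  using infsum_reindex_bij_betw[OF bij_add_left[of g], of "\<lambda>h. (norm (ell2_nth \<xi> h))\<^sup>2"] by simp

text \<open>The unitaries of the regular representation: \<open>(L\<^sub>g \<xi>)(h) = \<xi>(g\<^sup>-\<^sup>1h)\<close>.\<close>

lift_definition L :: "'g::group_add \<Rightarrow> (('g, 'h::complex_hilbert) ell2 \<Rightarrow>\<^sub>L ('g, 'h) ell2)"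
  is translate
proof (rule bounded_linear_intro[where K = 1])
  show "translate g (x + y) = translate g x + translate g y" for g and x y :: "('g, 'h) ell2"
    by transfer simp
  show "translate g (r *\<^sub>R x) = r *\<^sub>R translate g x" for g r and x :: "('g, 'h) ell2"
    by transfer simp
qed (simp add: norm_translate)

text \<open>The copy of the C*-algebra on \<open>\<ell>\<^sup>2(G, H)\<close>: \<open>(A \<xi>)(h) = \<pi>(\<alpha>\<^sub>h\<^sup>-\<^sup>1(A)) \<xi>(h)\<close>.\<close>

definition emb :: "('g::group_add \<Rightarrow> 'a::cstar_algebra \<Rightarrow> 'a) \<Rightarrow>
    ('a \<Rightarrow> ('h::complex_hilbert \<Rightarrow>\<^sub>L 'h)) \<Rightarrow> 'a \<Rightarrow> (('g, 'h) ell2 \<Rightarrow>\<^sub>L ('g, 'h) ell2)" where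
  "emb \<alpha> \<pi> a = Blinfun (\<lambda>\<xi>. Abs_ell2 (\<lambda>h. \<pi> (\<alpha> (- h) a) (ell2_nth \<xi> h)))"

lemma ell2_nth_emb:
  fixes \<alpha> :: "'g::group_add \<Rightarrow> 'a::cstar_algebra \<Rightarrow> 'a"
    and \<pi> :: "'a \<Rightarrow> ('h::complex_hilbert \<Rightarrow>\<^sub>L 'h)"
  assumes \<alpha>: "star_action \<alpha>" and \<pi>: "star_representation \<pi>"
  shows "ell2_nth (emb \<alpha> \<pi> a \<xi>) h = \<pi> (\<alpha> (- h) a) (ell2_nth \<xi> h)"
proof -
  define T where "T h = \<pi> (\<alpha> (- h) a)" for h
  define F where "F \<xi> = Abs_ell2 (\<lambda>h. T h (ell2_nth \<xi> h))" for \<xi>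
  have "star_automorphism (\<alpha> (- h))" for h
    using \<alpha> by (simp add: star_action_def)
  then have "norm (T h) \<le> norm a" for h
    unfolding T_def using star_representation_norm_le[OF star_representation_compose[OF \<pi>]] by blast
  then have "norm (T h v) \<le> norm a * norm v" for h v
    using norm_blinfun[of "T h" v] by (meson mult_right_mono norm_ge_zero order_trans)
  then have le: "(norm (T h v))\<^sup>2 \<le> (norm a)\<^sup>2 * (norm v)\<^sup>2" for h v
    using power_mono[of "norm (T h v)" "norm a * norm v" 2] by (simp add: power_mult_distrib)
  have sumR: "(\<lambda>h. (norm a)\<^sup>2 * (norm (ell2_nth \<xi> h))\<^sup>2) summable_on UNIV" for \<xi> :: "('g, 'h) ell2"
    by (intro summable_on_cmult_right ell2_summable)
  have sumL: "(\<lambda>h. (norm (T h (ell2_nth \<xi> h)))\<^sup>2) summable_on UNIV" for \<xi>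
    by (rule summable_on_comparison_test[OF sumR[of \<xi>]]) (auto simp: le)
  have F: "ell2_nth (F \<xi>) h = T h (ell2_nth \<xi> h)" for \<xi> h
    using sumL by (simp add: F_def Abs_ell2_inverse)
  have "bounded_linear F"
  proof (rule bounded_linear_intro[where K = "norm a"])
    show "F (x + y) = F x + F y" for x y
      by (rule ell2_nth_inject[THEN iffD1]) (simp add: fun_eq_iff F plus_ell2.rep_eq blinfun.add_right)
    show "F (r *\<^sub>R x) = r *\<^sub>R F x" for r x
      by (rule ell2_nth_inject[THEN iffD1]) (simp add: fun_eq_iff F scaleR_ell2.rep_eq blinfun.scaleR_right)
    show "norm (F x) \<le> norm x * norm a" for x
    proof (rule power2_le_imp_le)
      have "(norm (F x))\<^sup>2 \<le> (\<Sum>\<^sub>\<infinity>h. (norm a)\<^sup>2 * (norm (ell2_nth x h))\<^sup>2)"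
        unfolding ell2_norm_sq F by (rule infsum_mono[OF sumL sumR]) (rule le)
      then show "(norm (F x))\<^sup>2 \<le> (norm x * norm a)\<^sup>2"
        by (simp add: infsum_cmult_right' power_mult_distrib ell2_norm_sq mult.commute)
    qed simp
  qed
  then have "emb \<alpha> \<pi> a \<xi> = F \<xi>"
    unfolding emb_def by (simp add: F_def[abs_def] T_def bounded_linear_Blinfun_apply)
  then show ?thesis
    by (simp add: F T_def)
qed

lemma cadjoint_L: "cadjoint (L g) = (L (- g) :: ('g::group_add, 'h::complex_hilbert) ell2 \<Rightarrow>\<^sub>L _)"
proof (rule cadjoint_eqI, unfold is_cadjoint_def, intro allI)
  fix x y :: "('g, 'h) ell2"
  show "cinner (L (- g) x) y = cinner x (L g y)"
    unfolding cinner_ell2_def L.rep_eq translate.rep_eq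
    using infsum_reindex_bij_betw[OF bij_add_left[of g],
        of "\<lambda>h. cinner (ell2_nth x (g + h)) (ell2_nth y h)"]
    by (simp add: add.assoc[symmetric])
qed

lemma cadjoint_emb:
  assumes "star_action \<alpha>" "star_representation \<pi>"
  shows "cadjoint (emb \<alpha> \<pi> a) = emb \<alpha> \<pi> (adj a)"
proof (rule cadjoint_eqI, unfold is_cadjoint_def, intro allI)
  fix x y
  have "\<alpha> h (adj a) = adj (\<alpha> h a)" for h
    using assms(1) by (simp add: star_action_def star_automorphism_def)
  then show "cinner (emb \<alpha> \<pi> (adj a) x) y = cinner x (emb \<alpha> \<pi> a y)"
    unfolding cinner_ell2_def ell2_nth_emb[OF assms]
    using assms(2) by (simp add: star_representation_def is_cadjoint_def)
qed

lemma L_emb_cadjoint_L: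
  assumes "star_action \<alpha>" "star_representation \<pi>"
  shows "L g o\<^sub>L emb \<alpha> \<pi> a o\<^sub>L cadjoint (L g) = emb \<alpha> \<pi> (\<alpha> g a)"
proof (rule blinfun_eqI, rule ell2_nth_inject[THEN iffD1], rule ext)
  fix x h
  have "\<alpha> (- h) (\<alpha> g a) = \<alpha> (- h + g) a"
    using assms(1) unfolding star_action_def by (metis comp_apply)
  then show "ell2_nth ((L g o\<^sub>L emb \<alpha> \<pi> a o\<^sub>L cadjoint (L g)) x) h = ell2_nth (emb \<alpha> \<pi> (\<alpha> g a) x) h"
    by (simp add: cadjoint_L L.rep_eq translate.rep_eq ell2_nth_emb[OF assms] minus_add
        add.assoc[symmetric])
qed

text \<open>The norm closure of the finitely supported elements of the regular representation built from a
  representation \<open>\<pi>\<close> of the C*-algebra. Up to isometric isomorphism it does not depend on the choice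
  of \<open>\<pi>\<close>, provided that \<open>\<pi>\<close> is faithful. Its norm is the operator norm.\<close>

definition reduced_crossed_product :: "('g::group_add \<Rightarrow> 'a::cstar_algebra \<Rightarrow> 'a) \<Rightarrow>
    ('a \<Rightarrow> ('h::complex_hilbert \<Rightarrow>\<^sub>L 'h)) \<Rightarrow> (('g, 'h) ell2 \<Rightarrow>\<^sub>L ('g, 'h) ell2) set" where
  "reduced_crossed_product \<alpha> \<pi> =
     closure {\<Sum>g | x g \<noteq> 0. L g o\<^sub>L emb \<alpha> \<pi> (x g) | x. finite {g. x g \<noteq> 0}}"


section \<open>Word length and growth\<close>

definition words :: "'g::group_add set \<Rightarrow> 'g \<Rightarrow> 'g list set" where
  "words S g = {w. set w \<subseteq> S \<union> uminus ` S \<and> sum_list w = g}"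

definition generates :: "'g::group_add set \<Rightarrow> bool" where
  "generates S \<longleftrightarrow> (\<forall>g. words S g \<noteq> {})"

definition word_length :: "'g::group_add set \<Rightarrow> 'g \<Rightarrow> nat" where
  "word_length S g = (LEAST n. \<exists>w\<in>words S g. length w = n)"

text \<open>For a finite generating set all balls are finite, so that the cardinalities are genuine.\<close>

definition polynomial_growth :: "'g::group_add set \<Rightarrow> bool" where
  "polynomial_growth S \<longleftrightarrow>
     (\<exists>p :: real poly. \<forall>k. real (card {g. word_length S g \<le> k}) \<le> poly p (real k))"

end

theory Submission
  imports Defs
begin

text \<open>By the Cauchy--Schwarz inequality, \<open>\<parallel>\<Sum>\<^sub>g T\<^sub>g u\<parallel> \<le> \<Sum>\<^sub>g \<parallel>T\<^sub>g u\<parallel>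
  \<le> (\<Sum>\<^sub>g 1 / w\<^sub>g)\<^sup>1\<^sup>/\<^sup>2 (\<Sum>\<^sub>g w\<^sub>g \<parallel>T\<^sub>g u\<parallel>\<^sup>2)\<^sup>1\<^sup>/\<^sup>2\<close>, and the
  last sum is the value at \<open>u\<close> of the quadratic form of \<open>\<Sum>\<^sub>g w\<^sub>g T\<^sub>g\<^sup>* T\<^sub>g\<close>. For
  \<open>T\<^sub>g = L\<^sub>g X\<^sub>g\<close> this is the second estimate since \<open>L\<^sub>g\<close> is unitary; for the adjoints it is the
  first. Polynomial growth of degree \<open>d\<close> makes the constant \<open>\<Sum>\<^sub>g (1 + |g|)\<^sup>-\<^sup>s\<^sup>-\<^sup>2\<close> finite for
  \<open>s = d + 1\<close>, because each sphere contributes at most a multiple of \<open>(1 + k)\<^sup>-\<^sup>3\<close>.\<close>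

lemma is_cadjointD: "is_cadjoint V T \<Longrightarrow> cinner (V x) y = cinner x (T y)"
  by (simp add: is_cadjoint_def)

lemma is_cadjoint_sym: "is_cadjoint V T \<Longrightarrow> is_cadjoint T V"
  unfolding is_cadjoint_def by (metis cinner_commute)

lemma is_cadjoint_compose:
  assumes "is_cadjoint V T" "is_cadjoint V' T'"
  shows "is_cadjoint (V' o\<^sub>L V) (T o\<^sub>L T')"
  using assms by (simp add: is_cadjoint_def)

text \<open>Since \<open>cadjoint\<close> is a definite description, the equation
  \<open>cadjoint_L\<close> does not return the adjoint relation. The relation itself follows by
  reindexing the sum that defines \<open>cinner\<close> along left translation.\<close>

lemma is_cadjoint_L: "is_cadjoint (L (- g)) (L g)"
  for g :: "'g::group_add"
  unfolding is_cadjoint_def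
proof (intro allI)
  fix x y :: "('g, 'h::complex_hilbert) ell2"
  show "cinner (L (- g) x) y = cinner x (L g y)"
    unfolding cinner_ell2_def L.rep_eq translate.rep_eq
    using infsum_reindex_bij_betw[OF bij_add_left[of g],
        of "\<lambda>h. cinner (ell2_nth x (g + h)) (ell2_nth y h)"]
    by (simp add: add.assoc[symmetric])
qed

lemma is_cadjoint_emb:
  assumes "star_action \<alpha>" "star_representation \<pi>"
  shows "is_cadjoint (emb \<alpha> \<pi> (adj a)) (emb \<alpha> \<pi> a)"
proof -
  have "\<alpha> h (adj a) = adj (\<alpha> h a)" for h
    using assms(1) by (simp add: star_action_def star_automorphism_def)
  then show ?thesis
    using star_representationD(5)[OF assms(2)]
    by (simp add: is_cadjoint_def cinner_ell2_def ell2_nth_emb[OF assms])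
qed

lemma L_minus_compose_L: "L (- g) o\<^sub>L L g = id_blinfun"
  for g :: "'g::group_add"
proof (rule blinfun_eqI, rule ell2_nth_inject[THEN iffD1], rule ext)
  fix x :: "('g, 'h::complex_hilbert) ell2" and h
  show "ell2_nth ((L (- g) o\<^sub>L L g) x) h = ell2_nth (id_blinfun x) h"
    by (simp add: L.rep_eq translate.rep_eq add.assoc[symmetric])
qed

lemma cinner_scaleR_left: "cinner (r *\<^sub>R x) y = of_real r * cinner x y"
  for x y :: "'a::complex_inner"
  using cinner_scaleC_left[of "complex_of_real r" x y] by (simp add: scaleC_of_real)

lemma cinner_sum_left: "cinner (\<Sum>i\<in>F. f i) y = (\<Sum>i\<in>F. cinner (f i) y)"
  for y :: "'a::complex_inner"
proof -
  have [simp]: "cinner 0 y = 0"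
    using cinner_add_left[of 0 0 y] by simp
  show ?thesis
    by (induction F rule: infinite_finite_induct) (simp_all add: cinner_add_left)
qed

text \<open>Moving \<open>T i\<close> across the inner product turns the weighted sum into
  \<open>cinner (B u) u\<close>, where \<open>B\<close> is the operator on the right;
  Cauchy--Schwarz then bounds it.\<close>

lemma sum_norm_square_le_norm_sum_adjoint_compose:
  fixes T V :: "'i \<Rightarrow> 'h::complex_hilbert \<Rightarrow>\<^sub>L 'h"
  assumes "\<And>i. i \<in> F \<Longrightarrow> is_cadjoint (V i) (T i)"
  shows "(\<Sum>i\<in>F. w i * (norm (T i u))\<^sup>2) \<le> norm (\<Sum>i\<in>F. w i *\<^sub>R (V i o\<^sub>L T i)) * (norm u)\<^sup>2"
proof -
  let ?B = "\<Sum>i\<in>F. w i *\<^sub>R (V i o\<^sub>L T i)"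
  have "complex_of_real (\<Sum>i\<in>F. w i * (norm (T i u))\<^sup>2) = (\<Sum>i\<in>F. of_real (w i) * cinner (V i (T i u)) u)"
    by (simp add: is_cadjointD[OF assms] cinner_self)
  also have "\<dots> = cinner (?B u) u"
    by (simp only: blinfun.sum_left blinfun.scaleR_left cinner_sum_left cinner_scaleR_left
        blinfun_apply_blinfun_compose)
  finally have "cmod (of_real (\<Sum>i\<in>F. w i * (norm (T i u))\<^sup>2)) \<le> norm (?B u) * norm u"
    by (simp only: cmod_cinner_le_mult)
  then have "(\<Sum>i\<in>F. w i * (norm (T i u))\<^sup>2) \<le> norm (?B u) * norm u"
    unfolding norm_of_real by (rule order_trans[OF abs_ge_self])
  also have "\<dots> \<le> norm ?B * norm u * norm u"
    by (intro mult_right_mono norm_blinfun) simp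
  finally show ?thesis
    by (simp add: power2_eq_square mult.assoc)
qed

text \<open>The norms are summed, rather than the vectors, so that the bound serves both estimates:
  the column one by the triangle inequality, the row one by duality.\<close>

lemma sum_norm_le_weighted:
  fixes T V :: "'i \<Rightarrow> 'h::complex_hilbert \<Rightarrow>\<^sub>L 'h"
  assumes "\<And>i. i \<in> F \<Longrightarrow> is_cadjoint (V i) (T i)"
    and w: "\<And>i. i \<in> F \<Longrightarrow> 0 < w i" and c: "(\<Sum>i\<in>F. 1 / w i) \<le> c"
  shows "(\<Sum>i\<in>F. norm (T i u)) \<le> sqrt c * sqrt (norm (\<Sum>i\<in>F. w i *\<^sub>R (V i o\<^sub>L T i))) * norm u"
proof -
  let ?B = "\<Sum>i\<in>F. w i *\<^sub>R (V i o\<^sub>L T i)"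
  have "0 \<le> (\<Sum>i\<in>F. 1 / w i)"
    using w by (intro sum_nonneg) (simp add: less_imp_le)
  with c have c0: "0 \<le> c" by linarith
  \<comment> \<open>The weight is split evenly: Cauchy--Schwarz is applied to the factors
    \<open>1 / sqrt (w i)\<close> and \<open>sqrt (w i) * norm (T i u)\<close>.\<close>
  have "(\<Sum>i\<in>F. norm (T i u))\<^sup>2 = (\<Sum>i\<in>F. (1 / sqrt (w i)) * (sqrt (w i) * norm (T i u)))\<^sup>2"
    using w by (intro arg_cong[where f = "\<lambda>x. x\<^sup>2"] sum.cong refl) (force simp: less_le)
  also have "\<dots> \<le> (\<Sum>i\<in>F. (1 / sqrt (w i))\<^sup>2) * (\<Sum>i\<in>F. (sqrt (w i) * norm (T i u))\<^sup>2)"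
    by (rule Cauchy_Schwarz_ineq_sum)
  also have "\<dots> = (\<Sum>i\<in>F. 1 / w i) * (\<Sum>i\<in>F. w i * (norm (T i u))\<^sup>2)"
    using w by (intro arg_cong2[where f = "(*)"] sum.cong refl)
      (simp_all add: power_mult_distrib power_divide less_imp_le)
  also have "\<dots> \<le> c * (norm ?B * (norm u)\<^sup>2)"
    using c c0 w by (intro mult_mono sum_norm_square_le_norm_sum_adjoint_compose assms sum_nonneg)
      (simp_all add: less_imp_le)
  also have "\<dots> = (sqrt c * sqrt (norm ?B) * norm u)\<^sup>2"
    using c0 by (simp add: power_mult_distrib)
  finally show ?thesis
    by (rule power2_le_imp_le) (use c0 in simp)
qed

lemma norm_sum_le_weighted_column:
  fixes T V :: "'i \<Rightarrow> 'h::complex_hilbert \<Rightarrow>\<^sub>L 'h"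
  assumes "\<And>i. i \<in> F \<Longrightarrow> is_cadjoint (V i) (T i)"
    and "\<And>i. i \<in> F \<Longrightarrow> 0 < w i" and "(\<Sum>i\<in>F. 1 / w i) \<le> c" and "0 \<le> c"
  shows "norm (\<Sum>i\<in>F. T i) \<le> sqrt c * sqrt (norm (\<Sum>i\<in>F. w i *\<^sub>R (V i o\<^sub>L T i)))"
proof (rule norm_blinfun_bound)
  fix u
  have "norm ((\<Sum>i\<in>F. T i) u) \<le> (\<Sum>i\<in>F. norm (T i u))"
    by (simp add: blinfun.sum_left norm_sum)
  also have "\<dots> \<le> sqrt c * sqrt (norm (\<Sum>i\<in>F. w i *\<^sub>R (V i o\<^sub>L T i))) * norm u"
    using assms by (intro sum_norm_le_weighted)
  finally show "norm ((\<Sum>i\<in>F. T i) u) \<le> sqrt c * sqrt (norm (\<Sum>i\<in>F. w i *\<^sub>R (V i o\<^sub>L T i))) * norm u" .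
qed (use assms(4) in simp)

text \<open>Duality: the value \<open>z\<close> of the sum at \<open>u\<close> is paired with
  itself, which moves each \<open>V i\<close> over to \<open>T i z\<close>. The preceding bound is
  used at \<open>z\<close>, and one factor \<open>norm z\<close> cancels unless
  \<open>z = 0\<close>.\<close>

lemma norm_sum_le_weighted_row:
  fixes T V :: "'i \<Rightarrow> 'h::complex_hilbert \<Rightarrow>\<^sub>L 'h"
  assumes adj: "\<And>i. i \<in> F \<Longrightarrow> is_cadjoint (V i) (T i)"
    and "\<And>i. i \<in> F \<Longrightarrow> 0 < w i" and "(\<Sum>i\<in>F. 1 / w i) \<le> c" and "0 \<le> c"
  shows "norm (\<Sum>i\<in>F. V i) \<le> sqrt c * sqrt (norm (\<Sum>i\<in>F. w i *\<^sub>R (V i o\<^sub>L T i)))"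
    (is "_ \<le> ?K")
proof (rule norm_blinfun_bound)
  fix u
  define z where "z = (\<Sum>i\<in>F. V i) u"
  have "complex_of_real ((norm z)\<^sup>2) = cinner (\<Sum>i\<in>F. V i u) z"
    by (simp only: cinner_self[symmetric]) (simp add: z_def blinfun.sum_left)
  also have "\<dots> = (\<Sum>i\<in>F. cinner u (T i z))"
    by (simp add: cinner_sum_left is_cadjointD[OF adj])
  finally have "(norm z)\<^sup>2 = cmod (\<Sum>i\<in>F. cinner u (T i z))"
    by (metis abs_power2 norm_of_real)
  also have "\<dots> \<le> (\<Sum>i\<in>F. norm u * norm (T i z))"
    by (intro sum_norm_le cmod_cinner_le_mult)
  also have "\<dots> \<le> norm u * (?K * norm z)"
    unfolding sum_distrib_left[symmetric]
    using assms by (intro mult_left_mono sum_norm_le_weighted) simp_all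
  finally have *: "norm z * norm z \<le> (?K * norm u) * norm z"
    by (simp add: power2_eq_square mult_ac)
  show "norm ((\<Sum>i\<in>F. V i) u) \<le> ?K * norm u"
  proof (cases "z = 0")
    case True
    then show ?thesis using assms(4) by (simp add: z_def)
  next
    case False
    with * show ?thesis by (simp add: z_def)
  qed
qed (use assms(4) in simp)

text \<open>The ball is covered by the sums of the finitely many short words in a finite alphabet.
  Finiteness matters because \<open>card\<close> of an infinite set is 0, and then the growth bound
  would say nothing about subsets.\<close>

lemma finite_word_length_ball:
  assumes "finite S" and "generates S"
  shows "finite {g. word_length S g \<le> k}"
proof (rule finite_subset)
  show "{g. word_length S g \<le> k} \<subseteq> sum_list ` {w. set w \<subseteq> S \<union> uminus ` S \<and> length w \<le> k}"
  proof
    fix g assume g: "g \<in> {g. word_length S g \<le> k}"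
    obtain w where "w \<in> words S g"
      using assms(2) by (auto simp: generates_def)
    \<comment> \<open>Some word represents \<open>g\<close>, so the \<open>LEAST\<close> in
      \<open>word_length\<close> is attained.\<close>
    then have "\<exists>n. \<exists>w\<in>words S g. length w = n" by blast
    from LeastI_ex[OF this] obtain w where "w \<in> words S g" "length w = word_length S g"
      unfolding word_length_def by blast
    then show "g \<in> sum_list ` {w. set w \<subseteq> S \<union> uminus ` S \<and> length w \<le> k}"
      using g by (auto simp: words_def)
  qed
qed (use assms(1) in \<open>simp add: finite_lists_length_le\<close>)

lemma poly_le_mult_power:
  fixes p :: "real poly"
  obtains C where "0 < C" "\<And>k. poly p (real k) \<le> C * (1 + real k) ^ degree p"
proof
  \<comment> \<open>The summand 1 keeps the constant positive for the zero polynomial. The base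
    \<open>1 + real k\<close> is at least 1, so the top power dominates all lower ones.\<close>
  let ?C = "1 + (\<Sum>i\<le>degree p. \<bar>coeff p i\<bar>)"
  show "0 < ?C"
    by (simp add: add_pos_nonneg sum_nonneg)
  show "poly p (real k) \<le> ?C * (1 + real k) ^ degree p" for k
  proof -
    have "poly p (real k) = (\<Sum>i\<le>degree p. coeff p i * real k ^ i)"
      by (rule poly_altdef)
    also have "\<dots> \<le> (\<Sum>i\<le>degree p. \<bar>coeff p i\<bar> * (1 + real k) ^ degree p)"
    proof (rule sum_mono)
      fix i assume "i \<in> {..degree p}"
      then have "real k ^ i \<le> (1 + real k) ^ degree p"
        by (intro order_trans[OF power_mono[of "real k" "1 + real k"] power_increasing]) auto
      then show "coeff p i * real k ^ i \<le> \<bar>coeff p i\<bar> * (1 + real k) ^ degree p"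
        by (intro mult_mono) auto
    qed
    also have "\<dots> \<le> ?C * (1 + real k) ^ degree p"
      by (simp add: sum_distrib_right[symmetric] distrib_right)
    finally show ?thesis .
  qed
qed

text \<open>A bound uniform over finite \<open>F\<close> is what the norm estimates use, since each
  element has finite support.\<close>

lemma polynomial_growth_weights_bounded:
  fixes S :: "'g::group_add set"
  assumes "finite S" and "generates S" and "polynomial_growth S"
  obtains c s :: real where "0 < c" "0 < s"
    "\<And>F. finite F \<Longrightarrow> (\<Sum>g\<in>F. 1 / (1 + real (word_length S g)) powr (s + 2)) \<le> c"
proof -
  let ?l = "word_length S"
  obtain p :: "real poly" where p: "real (card {g. ?l g \<le> k}) \<le> poly p (real k)" for k
    using assms(3) by (auto simp: polynomial_growth_def)
  obtain C where C: "0 < C" "\<And>k. poly p (real k) \<le> C * (1 + real k) ^ degree p"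
    using poly_le_mult_power by blast
  define d where "d = degree p"
  define q where "q k = inverse (real (Suc k) ^ 3)" for k
  have q: "summable q"
    unfolding q_def using inverse_power_summable[of 3, where 'a = real]
    by (subst summable_Suc_iff) simp
  have q0: "0 \<le> q k" for k by (simp add: q_def)
  show thesis
  proof
    \<comment> \<open>Witnesses: \<open>s = d + 1\<close> is positive even for \<open>d = 0\<close>,
      and \<open>s + 2\<close> is the natural number \<open>d + 3\<close>, so \<open>powr\<close>
      becomes an ordinary power.\<close>
    show "0 < C * (1 + suminf q)"
      using C(1) suminf_nonneg[OF q q0] by simp
    show "0 < real d + 1" by simp
    fix F :: "'g set" assume F: "finite F"
    have weight: "1 / (1 + real (?l g)) powr (real d + 1 + 2) = 1 / (1 + real (?l g)) ^ (d + 3)" for g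
      using powr_realpow[of "1 + real (?l g)" "d + 3"] by (simp add: add.assoc)
    have "(\<Sum>g\<in>F. 1 / (1 + real (?l g)) powr (real d + 1 + 2))
        = (\<Sum>k\<in>?l ` F. \<Sum>g\<in>{g\<in>F. ?l g = k}. 1 / (1 + real (?l g)) ^ (d + 3))"
      unfolding weight by (rule sum.image_gen[OF F])
    also have "\<dots> \<le> (\<Sum>k\<in>?l ` F. C * q k)"
    proof (rule sum_mono)
      fix k
      \<comment> \<open>Each sphere is crudely counted by its ball; the remaining factor
        \<open>(1 + k)\<close> to the power -3 is still summable.\<close>
      have "card {g\<in>F. ?l g = k} \<le> card {g. ?l g \<le> k}"
        by (intro card_mono finite_word_length_ball assms) auto
      then have "real (card {g\<in>F. ?l g = k}) \<le> C * (1 + real k) ^ d"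
        using p[of k] C(2)[of k] by (simp add: d_def)
      then have "real (card {g\<in>F. ?l g = k}) / (1 + real k) ^ (d + 3)
          \<le> C * (1 + real k) ^ d / (1 + real k) ^ (d + 3)"
        by (intro divide_right_mono) auto
      also have "\<dots> = C * q k"
        by (simp add: q_def power_add field_simps)
      finally show "(\<Sum>g\<in>{g\<in>F. ?l g = k}. 1 / (1 + real (?l g)) ^ (d + 3)) \<le> C * q k"
        by simp
    qed
    also have "\<dots> = C * sum q (?l ` F)"
      by (simp add: sum_distrib_left)
    also have "\<dots> \<le> C * (1 + suminf q)"
      using sum_le_suminf[OF q, of "?l ` F"] F q0 C(1)
      by (intro mult_left_mono) (simp_all add: add_increasing)
    finally show "(\<Sum>g\<in>F. 1 / (1 + real (?l g)) powr (real d + 1 + 2)) \<le> C * (1 + suminf q)" .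
  qed
qed

theorem theorem5p1:
  fixes \<alpha> :: "'g::group_add \<Rightarrow> 'a::cstar_algebra \<Rightarrow> 'a"
    and \<pi> :: "'a \<Rightarrow> ('h::complex_hilbert \<Rightarrow>\<^sub>L 'h)"
    and S :: "'g set"
  assumes "finite S" and "generates S" and "polynomial_growth S"
    and "star_action \<alpha>" and "faithful_representation \<pi>"
  shows "\<exists>M s :: real. M > 0 \<and> s > 0 \<and>
    (\<forall>X \<in> reduced_crossed_product \<alpha> \<pi>. \<forall>x :: 'g \<Rightarrow> 'a.
       finite {g. x g \<noteq> 0} \<and> X = (\<Sum>g | x g \<noteq> 0. L g o\<^sub>L emb \<alpha> \<pi> (x g)) \<longrightarrow>
       norm X \<le> M * sqrt (norm (\<Sum>g | x g \<noteq> 0. (1 + real (word_length S g)) powr (s + 2) *\<^sub>R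
         (L g o\<^sub>L emb \<alpha> \<pi> (x g) o\<^sub>L cadjoint (emb \<alpha> \<pi> (x g)) o\<^sub>L cadjoint (L g)))) \<and>
       norm X \<le> M * sqrt (norm (\<Sum>g | x g \<noteq> 0. (1 + real (word_length S g)) powr (s + 2) *\<^sub>R
         (cadjoint (emb \<alpha> \<pi> (x g)) o\<^sub>L emb \<alpha> \<pi> (x g)))))"
proof -
  have \<pi>: "star_representation \<pi>"
    using assms(5) by (simp add: faithful_representation_def)
  note emb_adj = is_cadjoint_emb[OF assms(4) \<pi>]
  \<comment> \<open>These constants depend on \<open>S\<close> alone, so \<open>M = sqrt c\<close>
    serves every finitely supported family \<open>x\<close>.\<close>
  obtain c s :: real where c: "0 < c" and s: "0 < s" and
    weights: "\<And>F. finite F \<Longrightarrow> (\<Sum>g\<in>F. 1 / (1 + real (word_length S g)) powr (s + 2)) \<le> c"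
    using polynomial_growth_weights_bounded[OF assms(1-3)] by blast
  have bounds: "norm (\<Sum>g | x g \<noteq> 0. L g o\<^sub>L emb \<alpha> \<pi> (x g)) \<le>
      sqrt c * sqrt (norm (\<Sum>g | x g \<noteq> 0. (1 + real (word_length S g)) powr (s + 2) *\<^sub>R
         (L g o\<^sub>L emb \<alpha> \<pi> (x g) o\<^sub>L cadjoint (emb \<alpha> \<pi> (x g)) o\<^sub>L cadjoint (L g)))) \<and>
    norm (\<Sum>g | x g \<noteq> 0. L g o\<^sub>L emb \<alpha> \<pi> (x g)) \<le>
      sqrt c * sqrt (norm (\<Sum>g | x g \<noteq> 0. (1 + real (word_length S g)) powr (s + 2) *\<^sub>R
         (cadjoint (emb \<alpha> \<pi> (x g)) o\<^sub>L emb \<alpha> \<pi> (x g))))"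
    if fin: "finite {g. x g \<noteq> 0}" for x
  proof -
    define T where "T g = L g o\<^sub>L emb \<alpha> \<pi> (x g)" for g
    define V where "V g = emb \<alpha> \<pi> (adj (x g)) o\<^sub>L L (- g)" for g
    have adj: "is_cadjoint (V g) (T g)" for g
      unfolding V_def T_def by (intro is_cadjoint_compose is_cadjoint_L emb_adj)
    have pos: "0 < (1 + real (word_length S g)) powr (s + 2)" for g
      by simp
    have row: "L g o\<^sub>L emb \<alpha> \<pi> (x g) o\<^sub>L cadjoint (emb \<alpha> \<pi> (x g)) o\<^sub>L cadjoint (L g) = T g o\<^sub>L V g" for g
      by (rule blinfun_eqI) (simp add: T_def V_def cadjoint_L cadjoint_emb[OF assms(4) \<pi>])
    \<comment> \<open>The unitaries meet in the middle and cancel, so no \<open>L g\<close> survives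
      in the second estimate.\<close>
    have "V g o\<^sub>L T g = emb \<alpha> \<pi> (adj (x g)) o\<^sub>L (L (- g) o\<^sub>L L g) o\<^sub>L emb \<alpha> \<pi> (x g)" for g
      by (rule blinfun_eqI) (simp add: T_def V_def)
    then have column: "cadjoint (emb \<alpha> \<pi> (x g)) o\<^sub>L emb \<alpha> \<pi> (x g) = V g o\<^sub>L T g" for g
      by (intro blinfun_eqI) (simp add: L_minus_compose_L cadjoint_emb[OF assms(4) \<pi>])
    show ?thesis
      \<comment> \<open>The row bound is used with the roles of \<open>T\<close> and
        \<open>V\<close> exchanged, hence the symmetric adjoint relation.\<close>
      unfolding row column unfolding T_def[symmetric]
      using c by (intro conjI norm_sum_le_weighted_row norm_sum_le_weighted_column
          is_cadjoint_sym[OF adj] adj pos weights[OF fin] less_imp_le)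
  qed
  show ?thesis
    using c s bounds by (intro exI[of _ "sqrt c"] exI[of _ s]) auto
qed

end
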